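(* Let $n\geqslant 3$. Let $\vec{k}=(k_1,\ldots,k_n)\in\mathbb{Z}^n$ with $k_i>0$ and $k_i\neq k_j$ for $i\neq j$, and let $\vec{h}\in\mathbb{N}^n$ with $1\leqslant h_1\leqslant\cdots\leqslant h_n$. Let $A$ be a real number and let $\vec{a}\in\mathbb{Z}^n$ satisfy $0<|a_i|\leqslant A$ for $i=1,\ldots,n$. Then for any (finite, nonempty) set of primes $\mathcal{Q}$, $$\frac{1}{\#\mathcal{Q}}\sum_{q\in\mathcal{Q}}\#\mathcal{U}_{n,q}(\vec{a},\vec{k},\vec{h})\ll h_3\exp\left(O\left(\frac{\log A}{\log\log A}+\log\log h_3\right)\right)+\frac{h_1h_2h_3\log h_3}{\#\mathcal{Q}\,\log\log h_3},$$ where the implied constants depend only on $n$ and $\vec{k}$.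
   Context: For a prime $q$, $\mathbb{F}_q$ is identified with $\{0,1,\ldots,q-1\}$ and $\|\zeta\|$ is the distance from a real $\zeta$ to the nearest integer. $\mathcal{U}_{n,q}(\vec{a},\vec{k},\vec{h})$ denotes the set of $u\in\mathbb{F}_q$ for which the Bohr set $\{s\in\mathbb{F}_q:\ \|a_j u^{k_j} s/q\|\leqslant h_j/q,\ j=1,\ldots,n\}$ contains some $s\neq0$; equivalently, the set of $u\in\mathbb{F}_q$ for which there exist $s\in\{1,\ldots,q-1\}$ and integers $x_j$, $|x_j|\leqslant h_j$, with $s a_j u^{k_j}\equiv x_j\pmod q$ for all $j$.
   Formalization: It is additionally assumed that each prime q in Q divides at most one of a_1, a_2, a_3 (otherwise, e.g. a=(q,q,q), A=q, Q={q}, the bound fails), and log is read as max(1, ln) so that log log A and log log h_3 are defined and positive. *)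

theory Defs
  imports Complex_Main "HOL-Computational_Algebra.Primes"
begin

definition dist_nearest_int :: "real \<Rightarrow> real" where
  "dist_nearest_int x = \<bar>x - of_int (round x)\<bar>"

text \<open>
  Vectors with \<open>n\<close> components are functions on \<open>nat\<close>, of which only the values at the indices
  \<open>1, \<dots>, n\<close> matter. The field with \<open>q\<close> elements is the set \<open>{0..<q}\<close>.
\<close>

definition bohr_set ::
  "nat \<Rightarrow> nat \<Rightarrow> (nat \<Rightarrow> int) \<Rightarrow> (nat \<Rightarrow> nat) \<Rightarrow> (nat \<Rightarrow> nat) \<Rightarrow> nat \<Rightarrow> nat set" where
  "bohr_set n q a k h u =
     {s \<in> {0..<q}. \<forall>j\<in>{1..n}.
        dist_nearest_int (of_int (a j) * of_nat u ^ k j * of_nat s / of_nat q)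
          \<le> of_nat (h j) / of_nat q}"

text \<open>
  If \<open>n = 3\<close> and \<open>q\<close> divides two of the \<open>a j\<close>, then the set below is all of \<open>{0..<q}\<close>, whatever the
  size of the \<open>h j \<ge> 1\<close>: the two corresponding conditions are void, and the third one can be met
  by a suitable \<open>s \<noteq> 0\<close>. Non-trivial upper bounds for its cardinality must exclude this.
\<close>

definition bohr_params ::
  "nat \<Rightarrow> nat \<Rightarrow> (nat \<Rightarrow> int) \<Rightarrow> (nat \<Rightarrow> nat) \<Rightarrow> (nat \<Rightarrow> nat) \<Rightarrow> nat set" where
  "bohr_params n q a k h = {u \<in> {0..<q}. \<exists>s\<in>bohr_set n q a k h u. s \<noteq> 0}"

text \<open>
  The usual convention for iterated logarithms in bounds with implied constants: the logarithm is
  bounded below by 1, so that \<open>log log x\<close> is defined and positive for small \<open>x\<close> as well. The iterate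
  \<open>log1 (log1 x)\<close> is \<open>ln (ln x)\<close> as soon as \<open>ln (ln x) \<ge> 1\<close>.
\<close>

definition log1 :: "real \<Rightarrow> real" where
  "log1 x = max 1 (ln x)"

end

theory Submission
  imports Defs "HOL-Number_Theory.Residues"
begin

text \<open>
  Only the first three indices matter. If \<open>u \<noteq> 0\<close> lies in the set for \<open>q\<close>, then
  \<open>s a\<^sub>i u\<^bsup>k\<^sub>i\<^esup> \<equiv> x\<^sub>i\<close> with \<open>\<bar>x\<^sub>i\<bar> \<le> h\<^sub>i\<close>; any two of the \<open>x\<^sub>i\<close> with \<open>q\<close> not dividing the corresponding
  \<open>a\<^sub>i\<close> determine \<open>u\<close> up to boundedly many choices, so the set always has \<open>O(h\<^sub>2 h\<^sub>3)\<close> elements.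
  Write \<open>M = log h\<^sub>3\<close>. If \<open>log A \<ge> M log M\<close>, then \<open>h\<^sub>3 \<le> exp (2 log A / log log A)\<close> and this suffices.

  Otherwise, eliminating \<open>s\<close> and \<open>u\<close> shows that \<open>q\<close> divides the value \<open>F(x)\<close> of a form that depends on
  \<open>a\<close> and \<open>k\<close> only. Primes \<open>q \<le> h\<^sub>3\<close> are handled by the trivial bound \<open>q\<close>. A value \<open>F(x) \<noteq> 0\<close> has
  \<open>O(log (A h\<^sub>3) / log h\<^sub>3) = O(log M)\<close> prime factors \<open>q > h\<^sub>3\<close>, and likewise few \<open>q > h\<^sub>3\<close> divide
  \<open>a\<^sub>1 a\<^sub>2 a\<^sub>3\<close>. If \<open>F(x) = 0\<close>, then the ratio of two of the \<open>x\<^sub>i\<close> is an \<open>e\<close>-th power, \<open>e \<ge> 2\<close>, times a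
  constant that depends on \<open>a\<close>; there are \<open>O(h\<^sub>3 log h\<^sub>3)\<close> such pairs, uniformly in the constant.
\<close>


section \<open>Ratios that are perfect powers up to a constant factor\<close>

text \<open>For \<open>c = 1\<close> this is equality in the group of positive rationals modulo
  \<open>e\<close>-th powers, hence an equivalence relation; a general \<open>c\<close> relates each
  class to a translate of it.\<close>

definition power_ratio_pairs :: "nat \<Rightarrow> rat \<Rightarrow> nat \<Rightarrow> (nat \<times> nat) set" where
  "power_ratio_pairs e c h =
     {(x, y). x \<in> {1..h} \<and> y \<in> {1..h} \<and> (\<exists>t>0. of_nat x = c * of_nat y * t ^ e)}"

lemma power_ratio_pairs_subset: "power_ratio_pairs e c h \<subseteq> {1..h} \<times> {1..h}"
  by (auto simp: power_ratio_pairs_def)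

lemma finite_power_ratio_pairs [simp]: "finite (power_ratio_pairs e c h)"
  by (rule finite_subset[OF power_ratio_pairs_subset]) simp

lemma sum_inverse_le_ln:
  assumes "n \<ge> 1"
  shows "(\<Sum>g=1..n. 1 / real g) \<le> 1 + ln (real n)"
  using assms
proof (induction n rule: dec_induct)
  case base
  then show ?case by simp
next
  case (step n)
  have "ln (real n / real (Suc n)) \<le> real n / real (Suc n) - 1"
    using step by (intro ln_le_minus_one) auto
  also have "\<dots> = - (1 / real (Suc n))"
    by (simp add: field_simps)
  finally have "1 / real (Suc n) \<le> ln (real (Suc n)) - ln (real n)"
    using step by (simp add: ln_div)
  with step.IH show ?case by simp
qed

text \<open>\<open>B\<close> consists of positive integers, so it has at most \<open>Max B\<close>
  elements, and \<open>g * Max B ^ 2 \<le> g * Max B ^ e \<le> h\<close>.\<close>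

lemma card_square_mult_le:
  fixes B :: "nat set"
  assumes "finite B" "0 \<notin> B" "e \<ge> 2" "\<And>p. p \<in> B \<Longrightarrow> g * p ^ e \<le> h"
  shows "card B ^ 2 * g \<le> h"
proof (cases "B = {}")
  case False
  have "B \<subseteq> {1..Max B}"
    using assms by (auto simp: Suc_le_eq intro: ccontr)
  then have "card B \<le> Max B"
    using card_mono[of "{1..Max B}" B] by simp
  moreover have "Max B \<in> B"
    using assms False by simp
  ultimately have "card B ^ 2 * g \<le> Max B ^ 2 * g" "Max B ^ 2 \<le> Max B ^ e" "g * Max B ^ e \<le> h"
    using assms by (auto intro!: power_increasing power_mono mult_right_mono simp: Suc_le_eq
        intro: ccontr)
  then show ?thesis
    by (metis le_trans mult.commute mult_le_mono1)
qed auto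

text \<open>Write \<open>t = p / r\<close> in lowest terms. Then
  \<open>x * r ^ e = y * p ^ e\<close>, and coprimality forces \<open>r ^ e\<close> to divide
  \<open>y\<close>; the quotient is \<open>g\<close>.\<close>

lemma power_ratio_pairs_1_param:
  assumes "(x, y) \<in> power_ratio_pairs e 1 h"
  obtains g p r where "g \<in> {1..h}" "p > 0" "r > 0" "x = g * p ^ e" "y = g * r ^ e"
proof -
  from assms obtain t :: rat where t: "t > 0" "of_nat x = of_nat y * t ^ e"
    and xy: "x \<in> {1..h}" "y \<in> {1..h}"
    by (auto simp: power_ratio_pairs_def)
  obtain P R where PR: "quotient_of t = (P, R)" by force
  then have R: "R > 0" "coprime P R" "t = of_int P / of_int R"
    using quotient_of_denom_pos quotient_of_coprime quotient_of_div by blast+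
  with t have "P > 0" by (simp add: zero_less_divide_iff)
  define p r where "p = nat P" and "r = nat R"
  have pr: "p > 0" "r > 0" "coprime p r" "t = of_nat p / of_nat r"
    using R \<open>P > 0\<close> by (auto simp: p_def r_def coprime_int_iff[symmetric])
  have "of_nat (x * r ^ e) = (of_nat (y * p ^ e) :: rat)"
    using t(2) pr by (simp add: power_divide field_simps)
  then have eq: "x * r ^ e = y * p ^ e"
    using of_nat_eq_iff by blast
  have "r ^ e dvd y * p ^ e"
    using eq by (metis dvd_triv_right)
  then have "r ^ e dvd y"
    using pr(3) by (simp add: coprime_dvd_mult_left_iff coprime_commute)
  then obtain g where g: "y = r ^ e * g" by (elim dvdE)
  have "x = g * p ^ e"
    using eq pr(2) unfolding g by simp
  moreover have "g \<in> {1..h}"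
    using xy pr(2) by (auto simp: g Suc_le_eq intro: order_trans[rotated])
  ultimately show thesis
    using that pr g by (simp add: mult.commute)
qed

text \<open>For fixed \<open>g\<close> in the parametrisation, \<open>p\<close> and \<open>r\<close>
  each take at most \<open>sqrt (h / g)\<close> values, which leaves \<open>h / g\<close> pairs; the
  harmonic sum over \<open>g\<close> produces the logarithm.\<close>

lemma card_power_ratio_pairs_1:
  assumes "e \<ge> 2" "h \<ge> 1"
  shows "real (card (power_ratio_pairs e 1 h)) \<le> real h * (1 + ln (real h))"
proof -
  define B where "B g = {p \<in> {1..h}. g * p ^ e \<le> h}" for g
  have B: "real (card (B g)) ^ 2 \<le> real h * (1 / real g)" if "g \<ge> 1" for g
  proof -
    have "card (B g) ^ 2 * g \<le> h"
      using assms by (intro card_square_mult_le) (auto simp: B_def)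
    then have "real (card (B g) ^ 2 * g) \<le> real h"
      using of_nat_le_iff by blast
    then show ?thesis using that by (simp add: field_simps)
  qed
  have "power_ratio_pairs e 1 h \<subseteq>
        (\<lambda>(g, p, r). (g * p ^ e, g * r ^ e)) ` (SIGMA g:{1..h}. B g \<times> B g)"
  proof clarify
    fix x y assume xy: "(x, y) \<in> power_ratio_pairs e 1 h"
    then obtain g p r where gpr: "g \<in> {1..h}" "p > 0" "r > 0" "x = g * p ^ e" "y = g * r ^ e"
      by (rule power_ratio_pairs_1_param)
    have "v \<in> B g" if "v > 0" "g * v ^ e \<le> h" for v
    proof -
      have "v \<le> v ^ e" using that assms by (intro self_le_power) auto
      also have "\<dots> \<le> g * v ^ e" using gpr by auto
      finally show ?thesis using that by (auto simp: B_def)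
    qed
    moreover have "x \<le> h" "y \<le> h"
      using xy by (auto simp: power_ratio_pairs_def)
    ultimately have "(g, p, r) \<in> (SIGMA g:{1..h}. B g \<times> B g)"
      using gpr by auto
    then show "(x, y) \<in> (\<lambda>(g, p, r). (g * p ^ e, g * r ^ e)) ` (SIGMA g:{1..h}. B g \<times> B g)"
      using gpr by (intro image_eqI[of _ _ "(g, p, r)"]) auto
  qed
  moreover have fin: "finite (SIGMA g:{1..h}. B g \<times> B g)"
    by (auto simp: B_def)
  ultimately have "card (power_ratio_pairs e 1 h) \<le> card (SIGMA g:{1..h}. B g \<times> B g)"
    by (rule surj_card_le[rotated])
  also have "\<dots> = (\<Sum>g=1..h. card (B g) ^ 2)"
    by (subst card_SigmaI) (auto simp: B_def card_cartesian_product power2_eq_square)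
  finally have "real (card (power_ratio_pairs e 1 h)) \<le> real (\<Sum>g=1..h. card (B g) ^ 2)"
    by (rule of_nat_mono)
  also have "\<dots> = (\<Sum>g=1..h. real (card (B g)) ^ 2)"
    by simp
  also have "\<dots> \<le> (\<Sum>g=1..h. real h * (1 / real g))"
    by (intro sum_mono B) auto
  also have "\<dots> = real h * (\<Sum>g=1..h. 1 / real g)"
    by (simp add: sum_distrib_left)
  also have "\<dots> \<le> real h * (1 + ln (real h))"
    using assms by (intro mult_left_mono sum_inverse_le_ln) auto
  finally show ?thesis .
qed

text \<open>
  The pairs match classes modulo \<open>e\<close>-th powers with one another. A product of the sizes of two
  matched classes is at most the square of the larger one, which reduces the count to \<open>c = 1\<close>.
\<close>

lemma card_power_ratio_pairs_le:
  assumes "c > 0"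
  shows "card (power_ratio_pairs e c h) \<le> 2 * card (power_ratio_pairs e 1 h)"
proof -
  define P where "P = power_ratio_pairs e c h"
  define R where "R = power_ratio_pairs e 1 h"
  define cls where "cls x = {y. (x, y) \<in> R}" for x
  have cls_sub: "cls x \<subseteq> {1..h}" for x
    by (auto simp: cls_def R_def power_ratio_pairs_def)
  then have fin: "finite (cls x)" for x
    using finite_subset by blast
  have R_Sigma: "R = (SIGMA x:{1..h}. cls x)"
    by (auto simp: cls_def R_def power_ratio_pairs_def)
  have ratio: "(x, y) \<in> R" if "x \<in> {1..h}" "y \<in> {1..h}" "s > 0" "t > 0"
    "of_nat x * t ^ e = of_nat y * s ^ e" for x y and s t :: rat
    using that by (auto simp: R_def power_ratio_pairs_def power_divide field_simps
        intro!: exI[of _ "s / t"])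
  \<comment> \<open>The constant \<open>c\<close> cancels, so all first components paired with one
    \<open>y\<close> lie in a single class; \<open>R_trans_snd\<close> is the same with the
    components exchanged.\<close>
  have R_trans_fst: "(x, x') \<in> R" if P: "(x, y) \<in> P" "(x', y) \<in> P" for x x' y
  proof -
    from P obtain s t where st: "s > 0" "t > 0" "of_nat x = c * of_nat y * s ^ e"
      "of_nat x' = c * of_nat y * t ^ e" "x \<in> {1..h}" "x' \<in> {1..h}"
      by (auto simp: P_def power_ratio_pairs_def)
    then show ?thesis
      by (intro ratio[of _ _ s t]) auto
  qed
  have R_trans_snd: "(y, y') \<in> R" if P: "(x, y) \<in> P" "(x, y') \<in> P" for x y y'
  proof -
    from P obtain s t where st: "s > 0" "t > 0" "of_nat x = c * of_nat y * s ^ e"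
      "of_nat x = c * of_nat y' * t ^ e" "y \<in> {1..h}" "y' \<in> {1..h}"
      by (auto simp: P_def power_ratio_pairs_def)
    then have "c * (of_nat y * s ^ e) = c * (of_nat y' * t ^ e)"
      by (metis mult.assoc)
    then show ?thesis
      using st assms by (intro ratio[of _ _ t s]) auto
  qed
  \<comment> \<open>\<open>P1\<close> is stored with swapped components, so that in both sets the
    first component has the class of larger or equal size and \<open>bound\<close> applies to
    each.\<close>
  define P1 where "P1 = {(y, x). (x, y) \<in> P \<and> card (cls x) \<le> card (cls y)}"
  define P2 where "P2 = {(x, y). (x, y) \<in> P \<and> card (cls y) \<le> card (cls x)}"
  \<comment> \<open>Above a fixed \<open>x\<close>, the set \<open>S\<close> stays within one class,
    which is no larger than \<open>cls x\<close>; the sizes of all \<open>cls x\<close> add up to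
    \<open>card R\<close>.\<close>
  have bound: "card S \<le> card R"
    if "S \<subseteq> {1..h} \<times> {1..h}"
      "\<And>x y y'. (x, y) \<in> S \<Longrightarrow> (x, y') \<in> S \<Longrightarrow> (y, y') \<in> R"
      "\<And>x y. (x, y) \<in> S \<Longrightarrow> card (cls y) \<le> card (cls x)" for S
  proof -
    have S: "S = (SIGMA x:{1..h}. {y. (x, y) \<in> S})"
      using that(1) by auto
    have finS: "finite {y. (x, y) \<in> S}" for x
      by (rule finite_subset[of _ "{1..h}"]) (use that(1) in auto)
    have "card {y. (x, y) \<in> S} \<le> card (cls x)" for x
    proof (cases "\<exists>y. (x, y) \<in> S")
      case True
      then obtain y where y: "(x, y) \<in> S" by blast
      then have "{y. (x, y) \<in> S} \<subseteq> cls y"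
        using that(2) by (auto simp: cls_def)
      then have "card {y. (x, y) \<in> S} \<le> card (cls y)"
        using fin by (intro card_mono)
      with that(3)[OF y] show ?thesis by simp
    qed auto
    then have "(\<Sum>x=1..h. card {y. (x, y) \<in> S}) \<le> (\<Sum>x=1..h. card (cls x))"
      by (intro sum_mono)
    then show ?thesis
      using finS fin by (subst S, subst R_Sigma) simp
  qed
  have Psub: "P \<subseteq> {1..h} \<times> {1..h}"
    unfolding P_def by (rule power_ratio_pairs_subset)
  have "card P1 \<le> card R"
    by (rule bound) (use Psub R_trans_fst in \<open>auto simp: P1_def\<close>)
  moreover have "card P2 \<le> card R"
    by (rule bound) (use Psub R_trans_snd in \<open>auto simp: P2_def\<close>)
  moreover have "P \<subseteq> prod.swap ` P1 \<union> P2"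
    by (force simp: P1_def P2_def)
  then have "card P \<le> card (prod.swap ` P1 \<union> P2)"
    by (rule card_mono[rotated])
      (auto simp: P1_def P2_def intro: finite_subset[OF _ finite_SigmaI[of "{1..h}" "\<lambda>_. {1..h}"]]
        dest: subsetD[OF Psub])
  then have "card P \<le> card P1 + card P2"
    using card_Un_le[of "prod.swap ` P1" P2] by (simp add: card_image)
  ultimately show ?thesis by (simp add: P_def R_def)
qed

text \<open>Cancelling the gcd from the exponents gives \<open>z ^ (a' + b') = w ^ a'\<close> with
  coprime exponents. A Bezout relation \<open>a' * x = (a' + b') * y + 1\<close> then yields
  \<open>w = (z ^ x / w ^ y) ^ (a' + b')\<close>, so no roots have to be extracted.\<close>

lemma power_eq_power_imp_perfect_power:
  fixes z w :: "'a :: linordered_field"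
  assumes "z ^ (a + b) = w ^ a" "a > 0" "b > 0" "z > 0" "w > 0"
  shows "\<exists>t>0. w = t ^ ((a + b) div gcd a b)"
proof -
  define g where "g = gcd a b"
  obtain a' b' where ab: "a = a' * g" "b = b' * g" "coprime a' b'"
    unfolding g_def using gcd_coprime_exists[of a b] assms(2) by auto
  have "g > 0" using assms(2) by (simp add: g_def)
  have "(z ^ (a' + b')) ^ g = (w ^ a') ^ g"
    using assms(1) unfolding ab by (simp add: power_mult[symmetric] algebra_simps)
  then have zw: "z ^ (a' + b') = w ^ a'"
    using \<open>g > 0\<close> assms by (subst (asm) power_eq_iff_eq_base) auto
  have "a' \<noteq> 0" using assms(2) ab by auto
  then obtain x y where xy: "a' * x = (a' + b') * y + gcd a' (a' + b')"
    using bezout_nat by blast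
  have "gcd a' (a' + b') = 1"
    using ab(3) by (simp add: coprime_iff_gcd_eq_1)
  with xy have "w * (w ^ y) ^ (a' + b') = w ^ (a' * x)"
    by (simp add: power_mult[symmetric] mult.commute del: distrib_left distrib_right)
  also have "\<dots> = (z ^ x) ^ (a' + b')"
    unfolding power_mult zw[symmetric] by (simp add: power_mult[symmetric] mult.commute)
  finally have "w = (z ^ x / w ^ y) ^ (a' + b')"
    using assms(5) by (simp add: power_divide field_simps)
  moreover have "(a + b) div gcd a b = a' + b'"
    using \<open>g > 0\<close> by (fold g_def) (simp add: ab flip: distrib_right)
  ultimately show ?thesis
    using assms by (intro exI[of _ "z ^ x / w ^ y"]) auto
qed

text \<open>Ensures that the exponent found above satisfies the condition \<open>e \<ge> 2\<close>
  of the pair count.\<close>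

lemma add_div_gcd_ge_2:
  fixes a b :: nat
  assumes "a > 0" "b > 0"
  shows "(a + b) div gcd a b \<ge> 2"
proof -
  have "gcd a b \<le> a" "gcd a b \<le> b" "gcd a b > 0"
    using assms by (auto intro: gcd_le1_nat gcd_le2_nat)
  then have "2 * gcd a b div gcd a b \<le> (a + b) div gcd a b"
    by (intro div_le_mono) auto
  with \<open>gcd a b > 0\<close> show ?thesis by simp
qed

section \<open>Congruences satisfied by the points of a Bohr set\<close>

lemma card_le_mult_card_image:
  assumes "finite U" "finite W" "f ` U \<subseteq> W" "\<And>w. w \<in> W \<Longrightarrow> card {u \<in> U. f u = w} \<le> d"
  shows "card U \<le> d * card W"
proof -
  have "U = (\<Union>w\<in>W. {u \<in> U. f u = w})"
    using assms(3) by auto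
  then have "card U \<le> (\<Sum>w\<in>W. card {u \<in> U. f u = w})"
    using card_UN_le[OF assms(2), of "\<lambda>w. {u \<in> U. f u = w}"] by simp
  also have "\<dots> \<le> (\<Sum>w\<in>W. d)"
    by (intro sum_mono assms)
  finally show ?thesis by (simp add: mult.commute)
qed

text \<open>Relative to one solution \<open>v\<close>, the unit \<open>b\<close> cancels and every
  solution satisfies \<open>u ^ m = v ^ m\<close> modulo \<open>q\<close>.\<close>

lemma card_roots_mod_prime_le:
  fixes b c :: int
  assumes "prime q" "m > 0" "\<not> int q dvd b"
  shows "card {u \<in> {0..<q}. [b * int u ^ m = c] (mod int q)} \<le> m"
proof (cases "{u \<in> {0..<q}. [b * int u ^ m = c] (mod int q)} = {}")
  case False
  then obtain v where v: "[b * int v ^ m = c] (mod int q)" by blast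
  have "{u \<in> {0..<q}. [b * int u ^ m = c] (mod int q)} \<subseteq> {u \<in> {..<q}. [u ^ m = v ^ m] (mod q)}"
  proof safe
    fix u assume "[b * int u ^ m = c] (mod int q)"
    then have "[b * int u ^ m = b * int v ^ m] (mod int q)"
      using v cong_sym cong_trans by blast
    moreover have "coprime b (int q)"
      using assms prime_imp_coprime[of "int q" b] by (simp add: coprime_commute)
    ultimately have "[int u ^ m = int v ^ m] (mod int q)"
      by (simp add: cong_mult_lcancel)
    then show "[u ^ m = v ^ m] (mod q)"
      by (simp flip: cong_int_iff)
  qed auto
  then have "card {u \<in> {0..<q}. [b * int u ^ m = c] (mod int q)}
      \<le> card {u \<in> {..<q}. [u ^ m = v ^ m] (mod q)}"
    by (intro card_mono) auto
  also have "\<dots> \<le> m"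
    using assms by (intro roots_mod_prime_bound)
  finally show ?thesis .
qed (simp only: card.empty)

lemma dist_nearest_int_le_imp_cong:
  assumes "q > 0" "dist_nearest_int (of_int N / of_nat q) \<le> real m / real q"
  obtains x where "\<bar>x\<bar> \<le> int m" "[N = x] (mod int q)"
proof
  \<comment> \<open>A representative of \<open>N\<close> of least absolute value modulo
    \<open>q\<close>; its absolute value is \<open>q\<close> times the distance in question.\<close>
  let ?x = "N - int q * round (of_int N / real q)"
  have "real_of_int \<bar>?x\<bar> = real q * dist_nearest_int (of_int N / of_nat q)"
    using assms(1) by (simp add: dist_nearest_int_def abs_mult[of "real q", symmetric, simplified]
        right_diff_distrib)
  also have "\<dots> \<le> real q * (real m / real q)"
    using assms by (intro mult_left_mono) auto
  also have "\<dots> = real_of_int (int m)"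
    using assms(1) by simp
  finally show "\<bar>?x\<bar> \<le> int m"
    by (simp only: of_int_le_iff)
  show "[N = ?x] (mod int q)"
    by (simp add: cong_iff_dvd_diff)
qed

lemma bohr_params_congruences:
  assumes "u \<in> bohr_params n q a k h"
  shows "\<exists>x s. \<not> int q dvd s \<and>
    (\<forall>j\<in>{1..n}. \<bar>x j\<bar> \<le> int (h j) \<and> [a j * int u ^ k j * s = x j] (mod int q))"
proof -
  from assms obtain s where s: "0 < s" "s < q" and
    dist: "\<forall>j\<in>{1..n}. dist_nearest_int (of_int (a j) * of_nat u ^ k j * of_nat s / of_nat q)
          \<le> of_nat (h j) / of_nat q"
    by (auto simp: bohr_params_def bohr_set_def)
  have "\<forall>j\<in>{1..n}. \<exists>x. \<bar>x\<bar> \<le> int (h j) \<and> [a j * int u ^ k j * int s = x] (mod int q)"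
  proof
    fix j assume j: "j \<in> {1..n}"
    have "dist_nearest_int (of_int (a j * int u ^ k j * int s) / of_nat q) \<le> real (h j) / real q"
      using dist j by simp
    then show "\<exists>x. \<bar>x\<bar> \<le> int (h j) \<and> [a j * int u ^ k j * int s = x] (mod int q)"
      using dist_nearest_int_le_imp_cong[of q "a j * int u ^ k j * int s" "h j"] s by force
  qed
  then have "\<exists>x. \<forall>j\<in>{1..n}. \<bar>x j\<bar> \<le> int (h j) \<and> [a j * int u ^ k j * int s = x j] (mod int q)"
    by (rule bchoice)
  moreover have "\<not> int q dvd int s"
    using s by (auto dest: dvd_imp_le)
  ultimately show ?thesis by blast
qed

text \<open>Zero is left out because \<open>x j\<close> is a unit modulo \<open>q\<close> whenever
  \<open>a j\<close> is; a box then has exactly \<open>8 * h i * h j * h l\<close> points.\<close>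

definition punctured_interval :: "nat \<Rightarrow> int set" where
  "punctured_interval m = {x. x \<noteq> 0 \<and> \<bar>x\<bar> \<le> int m}"

lemma finite_punctured_interval [simp]: "finite (punctured_interval m)"
  and card_punctured_interval [simp]: "card (punctured_interval m) = 2 * m"
proof -
  have *: "punctured_interval m = {- int m..int m} - {0}"
    by (auto simp: punctured_interval_def)
  show "finite (punctured_interval m)"
    by (simp add: *)
  show "card (punctured_interval m) = 2 * m"
    unfolding * by (subst card_Diff_singleton) auto
qed

text \<open>The purely algebraic part of membership in the parameter set, without the size bounds on
  \<open>x\<close>. The point \<open>u = 0\<close> is excluded here and later costs a summand
  1.\<close>

locale bohr_point =
  fixes q :: nat and u :: nat and s :: int and a :: "nat \<Rightarrow> int" and k :: "nat \<Rightarrow> nat"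
    and x :: "nat \<Rightarrow> int" and J :: "nat set"
  assumes prime_q: "prime q" and unit_u: "\<not> int q dvd int u" and unit_s: "\<not> int q dvd s"
    and cong: "j \<in> J \<Longrightarrow> [a j * int u ^ k j * s = x j] (mod int q)"
begin

lemma unit_x:
  assumes "j \<in> J" "\<not> int q dvd a j"
  shows "\<not> int q dvd x j"
proof -
  have "prime (int q)" using prime_q by simp
  moreover from this have "\<not> int q dvd int u ^ k j"
    using unit_u prime_dvd_power by blast
  ultimately have "\<not> int q dvd a j * int u ^ k j * s"
    using assms unit_s by (simp add: prime_dvd_mult_iff)
  then show ?thesis
    using cong[OF assms(1)] cong_dvd_iff by blast
qed

text \<open>Eliminates \<open>s\<close>: both sides are congruent to
  \<open>a i * a j * s * u ^ k j\<close>.\<close>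

lemma pair_cong:
  assumes "i \<in> J" "j \<in> J" "k i \<le> k j"
  shows "[(a j * x i) * int u ^ (k j - k i) = a i * x j] (mod int q)"
proof -
  have "[(a j * x i) * int u ^ (k j - k i)
      = (a j * (a i * int u ^ k i * s)) * int u ^ (k j - k i)] (mod int q)"
    using cong[OF assms(1)] by (intro cong_mult cong_refl) (rule cong_sym)
  also have "(a j * (a i * int u ^ k i * s)) * int u ^ (k j - k i)
      = a i * (a j * (int u ^ k i * int u ^ (k j - k i)) * s)"
    by (simp only: mult_ac)
  also have "int u ^ k i * int u ^ (k j - k i) = int u ^ k j"
    using assms(3) by (simp flip: power_add)
  also have "[a i * (a j * int u ^ k j * s) = a i * x j] (mod int q)"
    using cong[OF assms(2)] by (intro cong_mult cong_refl)
  finally show ?thesis .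
qed

text \<open>Eliminates \<open>s\<close> and \<open>u\<close>. Since
  \<open>k j * (\<alpha> + \<beta>) = k i * \<beta> + k l * \<alpha>\<close>, the monomials
  \<open>w j = u ^ k j * s\<close> satisfy
  \<open>w j ^ (\<alpha> + \<beta>) = w i ^ \<beta> * w l ^ \<alpha>\<close>.\<close>

lemma triple_dvd:
  assumes "i \<in> J" "j \<in> J" "l \<in> J" "k j = k i + \<alpha>" "k l = k i + \<alpha> + \<beta>"
  shows "int q dvd x j ^ (\<alpha> + \<beta>) * a i ^ \<beta> * a l ^ \<alpha> - a j ^ (\<alpha> + \<beta>) * x i ^ \<beta> * x l ^ \<alpha>"
proof -
  define w where "w j = int u ^ k j * s" for j
  define v where "v j = a j * w j" for j
  have v: "[x j = v j] (mod int q)" if "j \<in> J" for j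
    using cong[OF that] unfolding v_def w_def by (simp add: cong_sym mult.assoc)
  have "k j * (\<alpha> + \<beta>) = k i * \<beta> + k l * \<alpha>"
    unfolding assms by (simp add: algebra_simps)
  then have "w j ^ (\<alpha> + \<beta>) = w i ^ \<beta> * w l ^ \<alpha>"
    unfolding w_def power_mult_distrib power_mult[symmetric] by (simp add: power_add)
  then have w: "v j ^ (\<alpha> + \<beta>) * a i ^ \<beta> * a l ^ \<alpha> = a j ^ (\<alpha> + \<beta>) * v i ^ \<beta> * v l ^ \<alpha>"
    unfolding v_def by (simp only: power_mult_distrib mult_ac)
  have "[x j ^ (\<alpha> + \<beta>) * a i ^ \<beta> * a l ^ \<alpha> = v j ^ (\<alpha> + \<beta>) * a i ^ \<beta> * a l ^ \<alpha>] (mod int q)"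
    using assms by (intro cong_mult cong_pow cong_refl v)
  also have "v j ^ (\<alpha> + \<beta>) * a i ^ \<beta> * a l ^ \<alpha> = a j ^ (\<alpha> + \<beta>) * v i ^ \<beta> * v l ^ \<alpha>"
    by (rule w)
  also have "[\<dots> = a j ^ (\<alpha> + \<beta>) * x i ^ \<beta> * x l ^ \<alpha>] (mod int q)"
    using assms by (intro cong_mult cong_pow cong_refl cong_sym[OF v])
  finally show ?thesis
    by (simp add: cong_iff_dvd_diff)
qed

end

text \<open>With \<open>y = \<bar>x / a\<bar>\<close> at each index, the equation reads
  \<open>(yj / yi) ^ (\<alpha> + \<beta>) = (yl / yi) ^ \<alpha>\<close>, so \<open>yl / yi\<close>
  is a perfect power. Only the two outer indices enter the conclusion.\<close>

lemma triple_eq_imp_power_ratio: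
  fixes ai aj al xi xj xl :: int
  assumes "xj ^ (\<alpha> + \<beta>) * ai ^ \<beta> * al ^ \<alpha> = aj ^ (\<alpha> + \<beta>) * xi ^ \<beta> * xl ^ \<alpha>"
    and "\<alpha> > 0" "\<beta> > 0" "ai \<noteq> 0" "aj \<noteq> 0" "al \<noteq> 0"
    and "xi \<in> punctured_interval m" "xj \<noteq> 0" "xl \<in> punctured_interval m"
  shows "(nat \<bar>xl\<bar>, nat \<bar>xi\<bar>)
    \<in> power_ratio_pairs ((\<alpha> + \<beta>) div gcd \<alpha> \<beta>) (of_int \<bar>al\<bar> / of_int \<bar>ai\<bar>) m"
proof -
  have nz: "xi \<noteq> 0" "xl \<noteq> 0" using assms by (auto simp: punctured_interval_def)
  define b :: "int \<Rightarrow> rat" where "b v = of_int \<bar>v\<bar>" for v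
  have b: "b v > 0" if "v \<noteq> 0" for v using that by (simp add: b_def)
  note b' = assms(4-6,8) nz
  have "b xj ^ (\<alpha> + \<beta>) * b ai ^ \<beta> * b al ^ \<alpha> = b aj ^ (\<alpha> + \<beta>) * b xi ^ \<beta> * b xl ^ \<alpha>"
    using arg_cong[OF assms(1), of b] by (simp add: b_def abs_mult power_abs)
  then have eq: "((b xj / b aj) / (b xi / b ai)) ^ (\<alpha> + \<beta>) = ((b xl / b al) / (b xi / b ai)) ^ \<alpha>"
    using b'[THEN b] by (simp add: power_divide power_mult_distrib power_add field_simps)
  have "\<exists>t>0. (b xl / b al) / (b xi / b ai) = t ^ ((\<alpha> + \<beta>) div gcd \<alpha> \<beta>)"
    using power_eq_power_imp_perfect_power[OF eq assms(2,3)] b'[THEN b] by simp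
  then obtain t where t: "t > 0" "(b xl / b al) / (b xi / b ai) = t ^ ((\<alpha> + \<beta>) div gcd \<alpha> \<beta>)"
    by blast
  have "b xl = b al / b ai * b xi * t ^ ((\<alpha> + \<beta>) div gcd \<alpha> \<beta>)"
    unfolding t(2)[symmetric] using b'[THEN b] by (simp add: field_simps)
  moreover have "of_nat (nat \<bar>v\<bar>) = b v" for v
    by (simp add: b_def)
  moreover have "nat \<bar>xl\<bar> \<in> {1..m}" "nat \<bar>xi\<bar> \<in> {1..m}"
    using assms(7,9) by (auto simp: punctured_interval_def)
  ultimately show ?thesis
    using t(1) by (auto simp: power_ratio_pairs_def b_def simp del: of_nat_nat intro!: exI[of _ t])
qed

section \<open>Counting signs and large prime divisors\<close>

lemma card_signed_pairs_le:
  assumes "finite P"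
  shows "card {(x :: int, y :: int). x \<noteq> 0 \<and> y \<noteq> 0 \<and> (nat \<bar>x\<bar>, nat \<bar>y\<bar>) \<in> P} \<le> 4 * card P"
proof -
  have "{(x :: int, y :: int). x \<noteq> 0 \<and> y \<noteq> 0 \<and> (nat \<bar>x\<bar>, nat \<bar>y\<bar>) \<in> P}
     \<subseteq> (\<lambda>((e, f), x, y). (e * int x, f * int y)) ` (({1, -1} \<times> {1, -1}) \<times> P)"
  proof clarify
    fix x y :: int assume *: "x \<noteq> 0" "y \<noteq> 0" "(nat \<bar>x\<bar>, nat \<bar>y\<bar>) \<in> P"
    show "(x, y) \<in> (\<lambda>((e, f), x, y). (e * int x, f * int y)) ` (({1, -1} \<times> {1, -1}) \<times> P)"
      using * by (intro image_eqI[of _ _ "((sgn x, sgn y), nat \<bar>x\<bar>, nat \<bar>y\<bar>)"])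
        (auto simp: sgn_if)
  qed
  then have "card {(x :: int, y :: int). x \<noteq> 0 \<and> y \<noteq> 0 \<and> (nat \<bar>x\<bar>, nat \<bar>y\<bar>) \<in> P}
     \<le> card ((({1, -1} \<times> {1, -1}) \<times> P) :: ((int \<times> int) \<times> nat \<times> nat) set)"
    using assms by (intro surj_card_le) auto
  also have "\<dots> = 4 * card P"
    by (simp add: card_cartesian_product)
  finally show ?thesis .
qed

text \<open>The product of the distinct primes in \<open>Q\<close> divides \<open>N\<close>, hence
  is at most \<open>\<bar>N\<bar>\<close>; take logarithms.\<close>

lemma card_prime_divisors_gt_le:
  fixes N :: int
  assumes "finite Q" "N \<noteq> 0" "\<And>q. q \<in> Q \<Longrightarrow> prime q \<and> int q dvd N \<and> q > m" "m \<ge> 1"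
  shows "real (card Q) * log1 (real m) \<le> 2 * ln (real_of_int \<bar>N\<bar>)"
proof -
  have "(\<Prod>q\<in>S. int q) dvd N" if "S \<subseteq> Q" for S
    using finite_subset[OF that assms(1)] that
  proof (induction S rule: finite_induct)
    case (insert q S)
    have "coprime (int q) (\<Prod>q\<in>S. int q)"
      using insert assms(3) by (intro prod_coprime_right) (auto intro!: primes_coprime)
    then show ?case
      using insert assms(3) by (auto intro!: divides_mult)
  qed auto
  then have "(\<Prod>q\<in>Q. int q) dvd N" by blast
  then have "(\<Prod>q\<in>Q. int q) \<le> \<bar>N\<bar>"
    using assms(2) by (intro zdvd_imp_le) auto
  then have le: "(\<Prod>q\<in>Q. real q) \<le> real_of_int \<bar>N\<bar>"
    by (metis (mono_tags, lifting) of_int_le_iff of_int_of_nat_eq of_int_prod prod.cong)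
  have pos: "q > 0" if "q \<in> Q" for q
    using assms(3)[OF that] by auto
  \<comment> \<open>The factor 2 pays for the truncation in \<open>log1\<close>: for small
    \<open>m\<close> only \<open>ln q \<ge> ln 2 \<ge> 1 / 2\<close> is available.\<close>
  have lnq: "log1 (real m) / 2 \<le> ln (real q)" if "q \<in> Q" for q
  proof -
    have "ln (1 / 2 :: real) \<le> 1 / 2 - 1"
      by (rule ln_le_minus_one) auto
    then have "1 / 2 \<le> ln (2 :: real)"
      by (simp add: ln_div)
    also have "\<dots> \<le> ln (real q)"
      using assms(3)[OF that] prime_ge_2_nat[of q] by simp
    finally have "1 / 2 \<le> ln (real q)" .
    moreover have "ln (real m) \<le> ln (real q)" "0 \<le> ln (real m)"
      using assms(3)[OF that] assms(4) by auto
    ultimately show ?thesis by (auto simp: log1_def)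
  qed
  have "real (card Q) * (log1 (real m) / 2) \<le> (\<Sum>q\<in>Q. ln (real q))"
    using sum_mono[OF lnq] by simp
  also have "\<dots> = ln (\<Prod>q\<in>Q. real q)"
    using assms(1) pos by (intro ln_prod[symmetric]) auto
  also have "\<dots> \<le> ln (real_of_int \<bar>N\<bar>)"
    using le pos by (intro ln_mono prod_pos) auto
  finally show ?thesis by simp
qed

text \<open>Fixes one vector of residues per \<open>u\<close>, so that \<open>u\<close> can be
  counted through the fibres of the map \<open>X\<close>.\<close>

lemma bohr_params_choice:
  assumes "prime q"
  obtains X where
    "\<And>u j. u \<in> bohr_params n q a k h - {0} \<Longrightarrow> j \<in> {1..n} \<Longrightarrow> \<bar>X u j\<bar> \<le> int (h j)"
    "\<And>u. u \<in> bohr_params n q a k h - {0} \<Longrightarrow> \<exists>s. bohr_point q u s a k (X u) {1..n}"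
proof -
  have "\<exists>x. (\<forall>j\<in>{1..n}. \<bar>x j\<bar> \<le> int (h j)) \<and> (\<exists>s. bohr_point q u s a k x {1..n})"
    if u: "u \<in> bohr_params n q a k h - {0}" for u
  proof -
    obtain x s where "\<not> int q dvd s"
      "\<forall>j\<in>{1..n}. \<bar>x j\<bar> \<le> int (h j) \<and> [a j * int u ^ k j * s = x j] (mod int q)"
      using bohr_params_congruences[of u n q a k h] u by blast
    moreover have "\<not> int q dvd int u"
      using u by (auto simp: bohr_params_def dest: dvd_imp_le)
    ultimately show ?thesis
      using assms by (intro exI[of _ x] conjI exI[of _ s]) (auto simp: bohr_point_def)
  qed
  then have "\<exists>X. \<forall>u\<in>bohr_params n q a k h - {0}. (\<forall>j\<in>{1..n}. \<bar>X u j\<bar> \<le> int (h j)) \<and>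
      (\<exists>s. bohr_point q u s a k (X u) {1..n})"
    by (intro bchoice) blast
  with that show thesis by blast
qed

text \<open>With both residues fixed, \<open>pair_cong\<close> is an equation for \<open>u\<close>
  of degree \<open>k j - k i\<close>. Its leading coefficient \<open>a j * v\<close> is a unit
  because \<open>v\<close> is.\<close>

lemma card_bohr_points_le:
  assumes "prime q" "i \<in> J" "j \<in> J" "k i < k j" "\<not> int q dvd a i" "\<not> int q dvd a j"
    and V: "V \<subseteq> {0..<q}" "\<And>u. u \<in> V \<Longrightarrow> \<exists>s x. bohr_point q u s a k x J \<and> x i = v \<and> x j = w"
  shows "card V \<le> k j - k i"
proof (cases "V = {}")
  case False
  then obtain u where "u \<in> V" by blast
  then obtain s x where "bohr_point q u s a k x J" "x i = v"
    using V(2) by blast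
  then have "\<not> int q dvd v"
    using bohr_point.unit_x assms by blast
  then have nd: "\<not> int q dvd a j * v"
    using assms by (simp add: prime_dvd_mult_iff)
  have "V \<subseteq> {u \<in> {0..<q}. [(a j * v) * int u ^ (k j - k i) = a i * w] (mod int q)}"
  proof
    fix u assume u: "u \<in> V"
    then obtain s x where "bohr_point q u s a k x J" "x i = v" "x j = w"
      using V(2) by blast
    then have "[(a j * v) * int u ^ (k j - k i) = a i * w] (mod int q)"
      using bohr_point.pair_cong[of q u s a k x J i j] assms by simp
    then show "u \<in> {u \<in> {0..<q}. [(a j * v) * int u ^ (k j - k i) = a i * w] (mod int q)}"
      using V(1) u by blast
  qed
  then have "card V \<le> card {u \<in> {0..<q}. [(a j * v) * int u ^ (k j - k i) = a i * w] (mod int q)}"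
    by (intro card_mono) auto
  also have "\<dots> \<le> k j - k i"
    using assms nd by (intro card_roots_mod_prime_le) auto
  finally show ?thesis .
qed auto

section \<open>Bounds for a single prime\<close>

lemma bohr_params_subset: "bohr_params n q a k h \<subseteq> {0..<q}"
  by (auto simp: bohr_params_def)

lemma finite_bohr_params [simp]: "finite (bohr_params n q a k h)"
  by (rule finite_subset[OF bohr_params_subset]) simp

lemma card_bohr_params_le: "card (bohr_params n q a k h) \<le> q"
  using card_mono[OF finite_atLeastLessThan bohr_params_subset] by simp

lemma card_le_1_plus_card_Diff:
  assumes "finite A"
  shows "card A \<le> 1 + card (A - {x})"
  using card_Suc_Diff1[OF assms, of x] by (cases "x \<in> A") auto

text \<open>There are \<open>4 * h i * h j\<close> pairs of nonzero residues, and each belongs to at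
  most \<open>k j - k i\<close> values of \<open>u\<close>.\<close>

lemma card_bohr_params_le_pair:
  assumes "prime q" "i \<in> {1..n}" "j \<in> {1..n}" "k i < k j" "\<not> int q dvd a i" "\<not> int q dvd a j"
  shows "card (bohr_params n q a k h) \<le> 1 + (k j - k i) * (4 * h i * h j)"
proof -
  define U where "U = bohr_params n q a k h - {0}"
  obtain X where X: "\<And>u j. u \<in> U \<Longrightarrow> j \<in> {1..n} \<Longrightarrow> \<bar>X u j\<bar> \<le> int (h j)"
    "\<And>u. u \<in> U \<Longrightarrow> \<exists>s. bohr_point q u s a k (X u) {1..n}"
    using bohr_params_choice[OF assms(1)] unfolding U_def by metis
  have nz: "X u l \<noteq> 0" if "u \<in> U" "l \<in> {i, j}" for u l
    using X(2)[OF that(1)] bohr_point.unit_x[of q u _ a k "X u" "{1..n}" l] that assms by auto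
  have "card U \<le> (k j - k i) * card (punctured_interval (h i) \<times> punctured_interval (h j))"
  proof (rule card_le_mult_card_image[where f = "\<lambda>u. (X u i, X u j)"])
    show "(\<lambda>u. (X u i, X u j)) ` U \<subseteq> punctured_interval (h i) \<times> punctured_interval (h j)"
      using X(1) nz assms by (auto simp: punctured_interval_def)
    show "card {u \<in> U. (X u i, X u j) = w} \<le> k j - k i" for w
    proof (rule card_bohr_points_le[of q i "{1..n}" j k a _ "fst w" "snd w"])
      show "{u \<in> U. (X u i, X u j) = w} \<subseteq> {0..<q}"
        using bohr_params_subset by (force simp: U_def)
      show "\<exists>s x. bohr_point q u s a k x {1..n} \<and> x i = fst w \<and> x j = snd w"
        if "u \<in> {u \<in> U. (X u i, X u j) = w}" for u
        using X(2)[of u] that by force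
    qed (use assms in auto)
  qed (auto simp: U_def)
  moreover have "card (bohr_params n q a k h) \<le> 1 + card U"
    unfolding U_def by (intro card_le_1_plus_card_Diff) simp
  ultimately show ?thesis
    by (simp add: card_cartesian_product algebra_simps)
qed

text \<open>The binomial of \<open>triple_dvd\<close>, homogeneous of degree
  \<open>\<alpha> + \<beta>\<close> both in the coefficients and in the residues. It involves
  neither \<open>q\<close> nor \<open>u\<close>, so its prime divisors can be counted point by
  point.\<close>

definition triple_form :: "nat \<Rightarrow> nat \<Rightarrow> int \<times> int \<times> int \<Rightarrow> int \<times> int \<times> int \<Rightarrow> int" where
  "triple_form \<alpha> \<beta> = (\<lambda>(a1, a2, a3) (x1, x2, x3).
     x2 ^ (\<alpha> + \<beta>) * a1 ^ \<beta> * a3 ^ \<alpha> - a2 ^ (\<alpha> + \<beta>) * x1 ^ \<beta> * x3 ^ \<alpha>)"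

text \<open>The values \<open>u \<noteq> 0\<close> are split by whether the form vanishes at their
  residues: zeros are counted by pairs of outer residues, the others by the points of
  \<open>box\<close>.\<close>

lemma card_bohr_params_le_triple:
  fixes \<alpha> \<beta> :: nat
  assumes "prime q" "i \<in> {1..n}" "j \<in> {1..n}" "l \<in> {1..n}"
    and k: "k j = k i + \<alpha>" "k l = k i + \<alpha> + \<beta>" "\<alpha> > 0" "\<beta> > 0"
    and a: "\<not> int q dvd a i" "\<not> int q dvd a j" "\<not> int q dvd a l"
    and h: "h i \<le> m" "h l \<le> m"
  defines "box \<equiv> punctured_interval (h i) \<times> punctured_interval (h j) \<times> punctured_interval (h l)"
  defines "F \<equiv> triple_form \<alpha> \<beta> (a i, a j, a l)"
  shows "card (bohr_params n q a k h) \<le> 1 + (\<alpha> + \<beta>) *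
    (4 * card (power_ratio_pairs ((\<alpha> + \<beta>) div gcd \<alpha> \<beta>) (of_int \<bar>a l\<bar> / of_int \<bar>a i\<bar>) m)
     + card {x \<in> box. F x \<noteq> 0 \<and> int q dvd F x})"
proof -
  define U where "U = bohr_params n q a k h - {0}"
  obtain X where X: "\<And>u j. u \<in> U \<Longrightarrow> j \<in> {1..n} \<Longrightarrow> \<bar>X u j\<bar> \<le> int (h j)"
    "\<And>u. u \<in> U \<Longrightarrow> \<exists>s. bohr_point q u s a k (X u) {1..n}"
    using bohr_params_choice[OF assms(1)] unfolding U_def by metis
  have nz: "X u v \<noteq> 0" if "u \<in> U" "v \<in> {i, j, l}" for u v
    using X(2)[OF that(1)] bohr_point.unit_x[of q u _ a k "X u" "{1..n}" v] that assms by auto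
  define x where "x u = (X u i, X u j, X u l)" for u
  have box: "x u \<in> box" if "u \<in> U" for u
    using X(1) nz that assms by (auto simp: box_def x_def punctured_interval_def)
  \<comment> \<open>The two outer residues already determine \<open>u\<close> up to
    \<open>k l - k i = \<alpha> + \<beta>\<close> choices, whichever of the two counts is
    used.\<close>
  have fibre: "card V \<le> \<alpha> + \<beta>" if "V \<subseteq> U" "\<And>u. u \<in> V \<Longrightarrow> X u i = v \<and> X u l = w" for V v w
  proof -
    have "card V \<le> k l - k i"
    proof (rule card_bohr_points_le[of q i "{1..n}" l k a V v w])
      show "V \<subseteq> {0..<q}"
        using that(1) bohr_params_subset by (force simp: U_def)
      show "\<exists>s x. bohr_point q u s a k x {1..n} \<and> x i = v \<and> x l = w" if "u \<in> V" for u
        using X(2)[of u] \<open>V \<subseteq> U\<close> \<open>u \<in> V \<Longrightarrow> X u i = v \<and> X u l = w\<close> that by blast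
    qed (use assms in auto)
    then show ?thesis by (simp add: k)
  qed
  define P where
    "P = power_ratio_pairs ((\<alpha> + \<beta>) div gcd \<alpha> \<beta>) (of_int \<bar>a l\<bar> / of_int \<bar>a i\<bar>) m"
  define P' where "P' = {(x :: int, y :: int). x \<noteq> 0 \<and> y \<noteq> 0 \<and> (nat \<bar>x\<bar>, nat \<bar>y\<bar>) \<in> P}"
  have "P' \<subseteq> {- int m..int m} \<times> {- int m..int m}"
  proof clarify
    fix x y assume "(x, y) \<in> P'"
    then have "(nat \<bar>x\<bar>, nat \<bar>y\<bar>) \<in> {1..m} \<times> {1..m}"
      using power_ratio_pairs_subset unfolding P'_def P_def by blast
    then show "x \<in> {- int m..int m} \<and> y \<in> {- int m..int m}" by auto
  qed
  then have finP': "finite P'"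
    by (rule finite_subset) auto
  define B where "B = {x \<in> box. F x \<noteq> 0 \<and> int q dvd F x}"
  have finB: "finite B"
    by (auto simp: B_def box_def)
  define U0 where "U0 = {u \<in> U. F (x u) = 0}"
  define U1 where "U1 = {u \<in> U. F (x u) \<noteq> 0}"
  have fin: "finite U0" "finite U1"
    by (auto simp: U0_def U1_def U_def)
  have "card U0 \<le> (\<alpha> + \<beta>) * card P'"
  proof (rule card_le_mult_card_image[where f = "\<lambda>u. (X u l, X u i)"])
    show "(\<lambda>u. (X u l, X u i)) ` U0 \<subseteq> P'"
    proof clarify
      fix u assume "u \<in> U0"
      then have u: "u \<in> U" "F (x u) = 0" by (auto simp: U0_def)
      have pi: "X u v \<in> punctured_interval m" if "v \<in> {i, l}" for v
        using X(1)[OF u(1), of v] nz[OF u(1), of v] that h assms(2,4)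
        by (auto simp: punctured_interval_def)
      have "(nat \<bar>X u l\<bar>, nat \<bar>X u i\<bar>) \<in> P"
        unfolding P_def
      proof (rule triple_eq_imp_power_ratio[of "X u j" \<alpha> \<beta> "a i" "a l" "a j"])
        show "X u j ^ (\<alpha> + \<beta>) * a i ^ \<beta> * a l ^ \<alpha> = a j ^ (\<alpha> + \<beta>) * X u i ^ \<beta> * X u l ^ \<alpha>"
          using u(2) by (simp add: F_def triple_form_def x_def)
      qed (use k(3,4) a nz[OF u(1)] pi in auto)
      then show "(X u l, X u i) \<in> P'"
        using nz[OF u(1)] by (simp add: P'_def)
    qed
    show "card {u \<in> U0. (X u l, X u i) = w} \<le> \<alpha> + \<beta>" for w
      by (rule fibre[of _ "snd w" "fst w"]) (auto simp: U0_def)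
  qed (use fin finP' in auto)
  also have "card P' \<le> 4 * card P"
    unfolding P'_def P_def by (intro card_signed_pairs_le) simp
  finally have U0: "card U0 \<le> (\<alpha> + \<beta>) * (4 * card P)" by simp
  have U1: "card U1 \<le> (\<alpha> + \<beta>) * card B"
  proof (rule card_le_mult_card_image[where f = x])
    show "x ` U1 \<subseteq> B"
    proof (rule image_subsetI)
      fix u assume "u \<in> U1"
      then have u: "u \<in> U" "F (x u) \<noteq> 0" by (auto simp: U1_def)
      obtain s where "bohr_point q u s a k (X u) {1..n}"
        using X(2)[OF u(1)] by blast
      then have "int q dvd F (x u)"
        using bohr_point.triple_dvd[of q u s a k "X u" "{1..n}" i j l \<alpha> \<beta>] assms(2-4) k
        by (simp add: F_def triple_form_def x_def)
      with u box show "x u \<in> B" by (simp add: B_def)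
    qed
    show "card {u \<in> U1. x u = w} \<le> \<alpha> + \<beta>" for w
      by (rule fibre[of _ "fst w" "snd (snd w)"]) (auto simp: U1_def x_def)
  qed (use fin finB in auto)
  have "card U \<le> card U0 + card U1"
  proof -
    have "U = U0 \<union> U1" by (auto simp: U0_def U1_def)
    then show ?thesis using card_Un_le by simp
  qed
  moreover have "card (bohr_params n q a k h) \<le> 1 + card U"
    unfolding U_def by (intro card_le_1_plus_card_Diff) simp
  ultimately have "card (bohr_params n q a k h) \<le> 1 + (\<alpha> + \<beta>) * (4 * card P + card B)"
    using U0 U1 by (simp add: distrib_left)
  then show ?thesis
    by (simp add: P_def B_def)
qed

text \<open>Each of the two terms is at most \<open>(A * M) ^ (\<alpha> + \<beta>)\<close>; the
  summand 1 covers \<open>ln 2\<close>.\<close>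

lemma ln_abs_triple_form_le:
  fixes A M :: real
  assumes a: "\<bar>of_int a1\<bar> \<le> A" "\<bar>of_int a2\<bar> \<le> A" "\<bar>of_int a3\<bar> \<le> A"
    and x: "\<bar>of_int x1\<bar> \<le> M" "\<bar>of_int x2\<bar> \<le> M" "\<bar>of_int x3\<bar> \<le> M"
    and "A \<ge> 1" "M \<ge> 1" "triple_form \<alpha> \<beta> (a1, a2, a3) (x1, x2, x3) \<noteq> 0"
  shows "ln (real_of_int \<bar>triple_form \<alpha> \<beta> (a1, a2, a3) (x1, x2, x3)\<bar>)
    \<le> 1 + real (\<alpha> + \<beta>) * (ln A + ln M)"
proof -
  define t1 :: real where "t1 = of_int x2 ^ (\<alpha> + \<beta>) * of_int a1 ^ \<beta> * of_int a3 ^ \<alpha>"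
  define t2 :: real where "t2 = of_int a2 ^ (\<alpha> + \<beta>) * of_int x1 ^ \<beta> * of_int x3 ^ \<alpha>"
  have "\<bar>t1\<bar> \<le> M ^ (\<alpha> + \<beta>) * A ^ \<beta> * A ^ \<alpha>"
    unfolding t1_def abs_mult power_abs using assms by (intro mult_mono power_mono) auto
  moreover have "\<bar>t2\<bar> \<le> A ^ (\<alpha> + \<beta>) * M ^ \<beta> * M ^ \<alpha>"
    unfolding t2_def abs_mult power_abs using assms by (intro mult_mono power_mono) auto
  ultimately have t: "\<bar>t1 - t2\<bar> \<le> 2 * (A * M) ^ (\<alpha> + \<beta>)"
    by (simp add: power_add power_mult_distrib mult_ac)
  have eq: "real_of_int \<bar>triple_form \<alpha> \<beta> (a1, a2, a3) (x1, x2, x3)\<bar> = \<bar>t1 - t2\<bar>"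
    by (simp add: triple_form_def t1_def t2_def)
  then have "\<bar>t1 - t2\<bar> > 0"
    using assms(9) by (metis of_int_0_less_iff zero_less_abs_iff)
  then have "ln \<bar>t1 - t2\<bar> \<le> ln (2 * (A * M) ^ (\<alpha> + \<beta>))"
    using t by (intro ln_mono) auto
  also have "\<dots> = ln 2 + real (\<alpha> + \<beta>) * (ln A + ln M)"
    using assms(7,8) by (simp add: ln_mult ln_realpow)
  also have "ln 2 \<le> (1 :: real)"
    using ln_le_minus_one[of 2] by simp
  finally show ?thesis unfolding eq by simp
qed

section \<open>Comparing iterated logarithms\<close>

lemma log1_ge_1: "log1 x \<ge> 1" and ln_le_log1: "ln x \<le> log1 x"
  by (auto simp: log1_def)

text \<open>For \<open>v = L / M\<close> both \<open>ln M\<close> and \<open>ln v\<close> are at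
  most \<open>v\<close>, hence \<open>ln L \<le> 2 * v\<close>. This lets \<open>L / log1 L\<close>
  dominate \<open>M\<close> when \<open>A\<close> is large.\<close>

lemma mult_log1_le:
  assumes "M \<ge> 1" "M * log1 M \<le> L"
  shows "M * log1 L \<le> 2 * L"
proof -
  define v where "v = L / M"
  have L: "L = M * v" and v: "v \<ge> log1 M"
    using assms by (auto simp: v_def field_simps)
  have "v \<ge> 1" using v log1_ge_1[of M] by linarith
  have "ln L = ln M + ln v"
    unfolding L using assms \<open>v \<ge> 1\<close> by (simp add: ln_mult)
  also have "\<dots> \<le> v + v"
    using v ln_le_log1[of M] ln_le_minus_one[of v] \<open>v \<ge> 1\<close> by linarith
  finally have "log1 L \<le> 2 * v"
    using \<open>v \<ge> 1\<close> by (simp add: log1_def)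
  then have "M * log1 L \<le> M * (2 * v)"
    using assms by (intro mult_left_mono) auto
  then show ?thesis by (simp add: L)
qed

text \<open>Follows from \<open>ln M = 2 * ln (sqrt M) \<le> 2 * sqrt M\<close>. It turns a factor
  \<open>log1 M\<close> into the shape \<open>M / log1 M\<close> of the final bound.\<close>

lemma log1_square_le:
  assumes "M \<ge> 1"
  shows "log1 M ^ 2 \<le> 4 * M"
proof (cases "ln M \<ge> 1")
  case True
  have "ln (sqrt M) \<le> sqrt M"
    using assms ln_le_minus_one[of "sqrt M"] by simp
  then have "ln M \<le> 2 * sqrt M"
    using assms by (simp add: ln_sqrt)
  then have "ln M ^ 2 \<le> (2 * sqrt M) ^ 2"
    using True by (intro power_mono) auto
  with True assms show ?thesis by (simp add: log1_def power_mult_distrib)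
next
  case False
  with assms show ?thesis by (simp add: log1_def)
qed

section \<open>Averaging over the primes\<close>

text \<open>\<open>few_dvd\<close> guarantees two unit coefficients among the first three, which
  rules out the degenerate sets that fill the whole field.\<close>

locale bohr_average =
  fixes n :: nat and k h :: "nat \<Rightarrow> nat" and A :: real and a :: "nat \<Rightarrow> int" and Q :: "nat set"
  assumes n_ge: "n \<ge> 3"
    and k_inj: "inj_on k {1..n}"
    and h_1: "1 \<le> h 1" and h_mono: "mono_on {1..n} h"
    and a_nz: "i \<in> {1..n} \<Longrightarrow> a i \<noteq> 0" and a_le: "i \<in> {1..n} \<Longrightarrow> real_of_int \<bar>a i\<bar> \<le> A"
    and fin_Q: "finite Q" and prime_Q: "q \<in> Q \<Longrightarrow> prime q"
    and few_dvd: "q \<in> Q \<Longrightarrow> card {i \<in> {1..3}. int q dvd a i} \<le> 1"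
begin

definition K :: nat where "K = k 1 + k 2 + k 3"
definition L :: real where "L = log1 A"
definition M :: real where "M = log1 (real (h 3))"
definition H :: real where "H = real (h 1) * real (h 2) * real (h 3)"

section \<open>Uniform bounds and elementary relations between the parameters\<close>

abbreviation U :: "nat \<Rightarrow> nat set" where "U q \<equiv> bohr_params n q a k h"

lemma in_range: "i \<in> {1, 2, 3} \<Longrightarrow> i \<in> {1..n}"
  using n_ge by auto

lemma h_le: "h 1 \<le> h 2" "h 2 \<le> h 3"
  using n_ge by (auto intro!: mono_onD[OF h_mono])

lemma k_neq: "k 1 \<noteq> k 2" "k 1 \<noteq> k 3" "k 2 \<noteq> k 3"
  using n_ge by (auto simp: inj_on_eq_iff[OF k_inj])

lemma K_ge_1: "K \<ge> 1"
  using k_neq by (auto simp: K_def)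

lemma A_ge_1: "A \<ge> 1"
  using a_le[of 1] a_nz[of 1] n_ge by auto

lemma M_ge_1: "M \<ge> 1" and ln_h_le: "ln (real (h 3)) \<le> M"
  by (auto simp: M_def log1_ge_1 ln_le_log1)

lemma L_ge_1: "L \<ge> 1" and ln_A_le: "ln A \<le> L"
  by (auto simp: L_def log1_ge_1 ln_le_log1)

lemma H_ge: "real (h 2) * real (h 3) \<le> H"
proof -
  have "1 * (real (h 2) * real (h 3)) \<le> real (h 1) * (real (h 2) * real (h 3))"
    using h_1 by (intro mult_right_mono) auto
  then show ?thesis by (simp add: H_def mult.assoc)
qed

text \<open>By \<open>few_dvd\<close> two of the three coefficients are units modulo
  \<open>q\<close>, and the pair bound applies to them. Since \<open>h\<close> is monotone, the pair
  with indices 2 and 3 is the worst.\<close>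

lemma card_U_le:
  assumes "q \<in> Q"
  shows "card (U q) \<le> 5 * K * (h 2 * h 3)"
proof -
  have pair: ?thesis if ij: "i \<in> {1, 2, 3}" "j \<in> {1, 2, 3}" "k i < k j"
    "\<not> int q dvd a i" "\<not> int q dvd a j" for i j
  proof -
    have "card (U q) \<le> 1 + (k j - k i) * (4 * (h i * h j))"
      using card_bohr_params_le_pair[of q i n j k a h] ij in_range prime_Q[OF assms]
      by (simp add: mult.assoc)
    also have "k j - k i \<le> K"
      using ij(2) by (auto simp: K_def)
    also have "h i * h j \<le> h 2 * h 3"
    proof -
      have *: "h v * h w \<le> h 2 * h 3" if "v \<in> {1, 2, 3}" "w \<in> {1, 2, 3}" "v < w" for v w
        using that h_le by (intro mult_mono) auto
      have "i \<noteq> j" using ij(3) by auto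
      then show ?thesis
        using *[of i j] *[of j i] ij(1,2) by (metis linorder_neqE_nat mult.commute)
    qed
    also have "1 \<le> K * (h 2 * h 3)"
      using K_ge_1 h_1 h_le by (simp add: Suc_le_eq)
    finally show ?thesis by (simp add: mult_ac)
  qed
  have one: "\<not> (int q dvd a i \<and> int q dvd a j)" if "i \<in> {1..3}" "j \<in> {1..3}" "i \<noteq> j" for i j
  proof
    assume "int q dvd a i \<and> int q dvd a j"
    then have "card {i, j} \<le> card {i \<in> {1..3}. int q dvd a i}"
      using that by (intro card_mono) auto
    with few_dvd[OF assms] that show False by simp
  qed
  have "\<exists>i\<in>{1, 2, 3}. \<exists>j\<in>{1, 2, 3}. i \<noteq> j \<and> \<not> int q dvd a i \<and> \<not> int q dvd a j"
    using one[of 1 2] one[of 1 3] one[of 2 3] by auto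
  then obtain i j where ij: "i \<in> {1, 2, 3}" "j \<in> {1, 2, 3}" "i \<noteq> j"
    "\<not> int q dvd a i" "\<not> int q dvd a j" by blast
  then have "k i \<noteq> k j"
    using in_range inj_on_eq_iff[OF k_inj] by blast
  then show ?thesis
    using pair ij by (metis linorder_neqE_nat)
qed

text \<open>In this range \<open>h 3\<close>, and with it \<open>h 2\<close>, is at most
  \<open>exp (2 * (L / log1 L))\<close>, so the bound \<open>h 2 * h 3\<close> for each prime is
  good enough.\<close>

lemma sum_card_U_le_large_A:
  assumes "M * log1 M \<le> L"
  shows "(\<Sum>q\<in>Q. real (card (U q))) \<le> real (card Q) * (5 * real K * (h 3 * exp (2 * (L / log1 L))))"
proof -
  have "M * log1 L \<le> 2 * L"
    using assms M_ge_1 by (intro mult_log1_le)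
  then have "M \<le> 2 * (L / log1 L)"
    using log1_ge_1[of L] by (simp add: field_simps)
  then have "ln (real (h 3)) \<le> 2 * (L / log1 L)"
    using ln_h_le by linarith
  then have "exp (ln (real (h 3))) \<le> exp (2 * (L / log1 L))"
    by simp
  then have "real (h 3) \<le> exp (2 * (L / log1 L))"
    using h_1 h_le by simp
  then have h2: "real (h 2) \<le> exp (2 * (L / log1 L))"
    using h_le by linarith
  have "real (card (U q)) \<le> 5 * real K * (h 3 * exp (2 * (L / log1 L)))" if "q \<in> Q" for q
  proof -
    have "real (card (U q)) \<le> real (5 * K * (h 2 * h 3))"
      using card_U_le[OF that] of_nat_mono by blast
    also have "\<dots> = 5 * real K * (h 3 * real (h 2))" by simp
    also have "\<dots> \<le> 5 * real K * (h 3 * exp (2 * (L / log1 L)))"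
      using h2 by (intro mult_left_mono) auto
    finally show ?thesis .
  qed
  then have "(\<Sum>q\<in>Q. real (card (U q))) \<le> (\<Sum>q\<in>Q. 5 * real K * (h 3 * exp (2 * (L / log1 L))))"
    by (intro sum_mono)
  then show ?thesis by simp
qed

definition "Q_dvd = {q \<in> Q. q > h 3 \<and> int q dvd a 1 * a 2 * a 3}"
definition "Q_coprime = {q \<in> Q. q > h 3 \<and> \<not> int q dvd a 1 * a 2 * a 3}"

text \<open>Each prime above \<open>h 3\<close> weighs at least \<open>M / 2\<close>, while the
  logarithm of \<open>\<bar>a 1 * a 2 * a 3\<bar>\<close> is at most \<open>3 * L\<close>.\<close>

lemma card_Q_dvd_le:
  assumes "L \<le> M * log1 M"
  shows "real (card Q_dvd) \<le> 6 * log1 M"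
proof -
  have nz: "a 1 \<noteq> 0" "a 2 \<noteq> 0" "a 3 \<noteq> 0"
    using a_nz n_ge by auto
  have ln_a: "ln (real_of_int \<bar>a i\<bar>) \<le> L" if "i \<in> {1, 2, 3}" for i
  proof -
    have "ln (real_of_int \<bar>a i\<bar>) \<le> ln A"
      using a_le[of i] a_nz[of i] in_range[OF that] by (intro ln_mono) auto
    with ln_A_le show ?thesis by linarith
  qed
  have "real (card Q_dvd) * M \<le> 2 * ln (real_of_int \<bar>a 1 * a 2 * a 3\<bar>)"
    unfolding M_def using nz fin_Q prime_Q h_1 h_le
    by (intro card_prime_divisors_gt_le) (auto simp: Q_dvd_def)
  also have "ln (real_of_int \<bar>a 1 * a 2 * a 3\<bar>) =
      ln (real_of_int \<bar>a 1\<bar>) + ln (real_of_int \<bar>a 2\<bar>) + ln (real_of_int \<bar>a 3\<bar>)"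
    using nz by (simp add: abs_mult ln_mult)
  also have "\<dots> \<le> 3 * L"
    using ln_a[of 1] ln_a[of 2] ln_a[of 3] by simp
  also have "\<dots> \<le> 3 * (M * log1 M)"
    using assms by simp
  finally have "real (card Q_dvd) * M \<le> (6 * log1 M) * M"
    by (simp add: mult_ac)
  then show ?thesis using M_ge_1 by simp
qed

text \<open>The zeros of the form give the first summand for each prime. For the second one, the sum
  over primes is exchanged with the sum over the box.\<close>

lemma sum_card_U_coprime_le:
  assumes "L \<le> M * log1 M"
  shows "(\<Sum>q\<in>Q_coprime. real (card (U q)))
    \<le> real (card Q) * (17 * real K * (h 3 * M)) + 48 * real K ^ 2 * (H * log1 M)"
proof -
  \<comment> \<open>The order of the exponents is independent of that of \<open>h\<close>, so the
    indices are sorted by \<open>k\<close>; \<open>H\<close> and the product of the coefficients are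
    symmetric.\<close>
  have "\<exists>(i, j, l)\<in>{(1, 2, 3), (1, 3, 2), (2, 1, 3), (2, 3, 1), (3, 1, 2), (3, 2, 1)}.
      k i < k j \<and> k j < k l"
    using k_neq by simp linarith
  then obtain i j l where
    ijl: "(i, j, l) \<in> {(1, 2, 3), (1, 3, 2), (2, 1, 3), (2, 3, 1), (3, 1, 2), (3, 2, 1)}"
    and k: "k i < k j" "k j < k l" by blast
  from ijl have mem: "i \<in> {1, 2, 3}" "j \<in> {1, 2, 3}" "l \<in> {1, 2, 3}"
    and H: "H = real (h i) * real (h j) * real (h l)"
    and prod_a: "a 1 * a 2 * a 3 = a i * a j * a l"
    by (auto simp: H_def)
  have h_le3: "h v \<le> h 3" if "v \<in> {1, 2, 3}" for v
    using that h_le by auto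
  define \<alpha> \<beta> where "\<alpha> = k j - k i" and "\<beta> = k l - k j"
  have kab: "k j = k i + \<alpha>" "k l = k i + \<alpha> + \<beta>" "\<alpha> > 0" "\<beta> > 0"
    using k by (auto simp: \<alpha>_def \<beta>_def)
  have K: "\<alpha> + \<beta> \<le> K"
    using mem(3) kab(2) by (auto simp: K_def)
  define box where
    "box = punctured_interval (h i) \<times> punctured_interval (h j) \<times> punctured_interval (h l)"
  define F where "F = triple_form \<alpha> \<beta> (a i, a j, a l)"
  define c :: rat where "c = of_int \<bar>a l\<bar> / of_int \<bar>a i\<bar>"
  define P where "P = power_ratio_pairs ((\<alpha> + \<beta>) div gcd \<alpha> \<beta>) c (h 3)"
  have fin_box: "finite box" and card_box: "real (card box) = 8 * H"
    by (auto simp: box_def card_cartesian_product H)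
  have "c > 0"
    using a_nz in_range mem by (simp add: c_def)
  have h3: "h 3 \<ge> 1" using h_1 h_le by simp
  have "real (card P) \<le> real (2 * card (power_ratio_pairs ((\<alpha> + \<beta>) div gcd \<alpha> \<beta>) 1 (h 3)))"
    unfolding P_def using card_power_ratio_pairs_le[OF \<open>c > 0\<close>] of_nat_mono by blast
  also have "\<dots> \<le> 2 * (real (h 3) * (1 + ln (real (h 3))))"
    using card_power_ratio_pairs_1[OF add_div_gcd_ge_2[OF kab(3,4)] h3] by simp
  also have "\<dots> \<le> 2 * (real (h 3) * (M + M))"
    using M_ge_1 ln_h_le by (intro mult_left_mono add_mono) auto
  finally have P: "real (card P) \<le> 4 * (h 3 * M)" by simp

  have Q_sub: "Q_coprime \<subseteq> Q" and fin: "finite Q_coprime"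
    using fin_Q by (auto simp: Q_coprime_def)
  define B where "B q = {x \<in> box. F x \<noteq> 0 \<and> int q dvd F x}" for q
  \<comment> \<open>17 is 4 sign choices times the 4 from the bound for \<open>P\<close>, plus 1 for
    \<open>u = 0\<close>.\<close>
  have U: "real (card (U q)) \<le> 17 * real K * (h 3 * M) + K * real (card (B q))" if q: "q \<in> Q_coprime" for q
  proof -
    have nd: "\<not> int q dvd a i" "\<not> int q dvd a j" "\<not> int q dvd a l"
      using q unfolding Q_coprime_def prod_a by auto
    have "card (U q) \<le> 1 + (\<alpha> + \<beta>) * (4 * card P + card (B q))"
      unfolding P_def c_def B_def box_def F_def
      using q Q_sub prime_Q mem in_range kab nd h_le3
      by (intro card_bohr_params_le_triple) auto
    also have "\<dots> \<le> 1 + K * (4 * card P + card (B q))"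
      using K by simp
    finally have "real (card (U q)) \<le> real (1 + K * (4 * card P + card (B q)))"
      using of_nat_mono by blast
    also have "\<dots> = 1 + K * (4 * real (card P)) + K * real (card (B q))"
      by (simp add: distrib_left)
    also have "K * (4 * real (card P)) \<le> K * (4 * (4 * (h 3 * M)))"
      using P by (intro mult_left_mono) auto
    also have "1 \<le> K * (h 3 * M)"
    proof -
      have "1 * (1 * 1) \<le> real K * (real (h 3) * M)"
        using K_ge_1 h3 M_ge_1 by (intro mult_mono) auto
      then show ?thesis by simp
    qed
    finally show ?thesis by (simp add: mult_ac)
  qed

  \<comment> \<open>The logarithm of a nonzero value is at most \<open>3 * K * M * log1 M\<close>,
    and \<open>card_prime_divisors_gt_le\<close> contributes the factor 2.\<close>
  have primes_le: "real (card {q \<in> Q_coprime. F x \<noteq> 0 \<and> int q dvd F x}) \<le> 6 * real K * log1 M"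
    if x: "x \<in> box" for x
  proof (cases "F x = 0")
    case True
    then show ?thesis using log1_ge_1[of M] by simp
  next
    case False
    obtain x1 x2 x3 where x_eq: "x = (x1, x2, x3)" by (cases x)
    have x_le: "\<bar>real_of_int y\<bar> \<le> real (h 3)" if "\<bar>y\<bar> \<le> int (h v)" "v \<in> {1, 2, 3}" for y v
      using that h_le3[of v] by linarith
    have "real (card {q \<in> Q_coprime. F x \<noteq> 0 \<and> int q dvd F x}) * M \<le> 2 * ln (real_of_int \<bar>F x\<bar>)"
      unfolding M_def
    proof (rule card_prime_divisors_gt_le)
      show "finite {q \<in> Q_coprime. F x \<noteq> 0 \<and> int q dvd F x}"
        using fin by simp
    qed (use False prime_Q h3 in \<open>auto simp: Q_coprime_def\<close>)
    also have "ln (real_of_int \<bar>F x\<bar>) \<le> 1 + real (\<alpha> + \<beta>) * (ln A + ln (real (h 3)))"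
      unfolding F_def x_eq
    proof (rule ln_abs_triple_form_le)
      show "triple_form \<alpha> \<beta> (a i, a j, a l) (x1, x2, x3) \<noteq> 0"
        using False by (simp add: F_def x_eq)
    qed (use a_le in_range mem x x_le A_ge_1 h3 in \<open>auto simp: x_eq box_def punctured_interval_def\<close>)
    also have "real (\<alpha> + \<beta>) * (ln A + ln (real (h 3))) \<le> K * (L + M)"
      using K ln_A_le ln_h_le A_ge_1 h3 L_ge_1 M_ge_1
      by (intro mult_mono add_mono) (auto simp: add_nonneg_nonneg simp flip: of_nat_add)
    also have "K * (L + M) \<le> K * (M * log1 M + M * log1 M)"
      using assms M_ge_1 log1_ge_1[of M] by (intro mult_left_mono add_mono) auto
    also have "1 \<le> K * (M * log1 M)"
    proof -
      have "1 * (1 * 1) \<le> real K * (M * log1 M)"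
        using K_ge_1 M_ge_1 log1_ge_1[of M] by (intro mult_mono) auto
      then show ?thesis by simp
    qed
    finally have "real (card {q \<in> Q_coprime. F x \<noteq> 0 \<and> int q dvd F x}) * M \<le> (6 * real K * log1 M) * M"
      by (simp add: algebra_simps)
    then show ?thesis using M_ge_1 by simp
  qed
  \<comment> \<open>Double counting of incidences between primes and box points.\<close>
  have "(\<Sum>q\<in>Q_coprime. card (B q)) = (\<Sum>x\<in>box. card {q \<in> Q_coprime. F x \<noteq> 0 \<and> int q dvd F x})"
    unfolding B_def using fin fin_box by (intro sum_multicount_gen) auto
  then have "(\<Sum>q\<in>Q_coprime. real (card (B q)))
      = (\<Sum>x\<in>box. real (card {q \<in> Q_coprime. F x \<noteq> 0 \<and> int q dvd F x}))"
    by (simp flip: of_nat_sum)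
  also have "\<dots> \<le> (\<Sum>x\<in>box. 6 * real K * log1 M)"
    by (intro sum_mono primes_le)
  also have "\<dots> = 48 * real K * (H * log1 M)"
    by (simp add: card_box)
  finally have sum_B: "(\<Sum>q\<in>Q_coprime. real (card (B q))) \<le> 48 * real K * (H * log1 M)" .

  have "(\<Sum>q\<in>Q_coprime. real (card (U q)))
      \<le> (\<Sum>q\<in>Q_coprime. 17 * real K * (h 3 * M) + K * real (card (B q)))"
    by (intro sum_mono U)
  also have "\<dots> = real (card Q_coprime) * (17 * real K * (h 3 * M)) + K * (\<Sum>q\<in>Q_coprime. real (card (B q)))"
    by (simp add: sum.distrib sum_distrib_left)
  also have "\<dots> \<le> real (card Q) * (17 * real K * (h 3 * M)) + K * (48 * real K * (H * log1 M))"
    using sum_B card_mono[OF fin_Q Q_sub] M_ge_1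
    by (intro add_mono mult_left_mono mult_right_mono) auto
  finally show ?thesis by (simp add: power2_eq_square mult_ac)
qed

text \<open>The primes up to \<open>h 3\<close> add 1 to the constant 17, and the at most
  \<open>6 * log1 M\<close> primes of \<open>Q_dvd\<close> add \<open>6 * 5 = 30\<close> to
  48.\<close>

lemma sum_card_U_le_small_A:
  assumes "L \<le> M * log1 M"
  shows "(\<Sum>q\<in>Q. real (card (U q)))
    \<le> real (card Q) * (18 * real K * (h 3 * M)) + 78 * real K ^ 2 * (H * log1 M)"
proof -
  define Q_small where "Q_small = {q \<in> Q. q \<le> h 3}"
  have fin: "finite Q_small" "finite Q_dvd" "finite Q_coprime"
    using fin_Q by (auto simp: Q_small_def Q_dvd_def Q_coprime_def)
  have "H \<ge> 0" by (simp add: H_def)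
  have Q: "Q = Q_small \<union> (Q_dvd \<union> Q_coprime)"
    by (auto simp: Q_small_def Q_dvd_def Q_coprime_def)
  have "(\<Sum>q\<in>Q. real (card (U q))) = (\<Sum>q\<in>Q_small. real (card (U q)))
      + ((\<Sum>q\<in>Q_dvd. real (card (U q))) + (\<Sum>q\<in>Q_coprime. real (card (U q))))"
  proof -
    have "Q_small \<inter> (Q_dvd \<union> Q_coprime) = {}" "Q_dvd \<inter> Q_coprime = {}"
      by (auto simp: Q_small_def Q_dvd_def Q_coprime_def)
    with fin show ?thesis
      by (subst Q) (simp add: sum.union_disjoint)
  qed
  moreover have "(\<Sum>q\<in>Q_small. real (card (U q))) \<le> real (card Q) * (K * (h 3 * M))"
  proof -
    have "(\<Sum>q\<in>Q_small. real (card (U q))) \<le> (\<Sum>q\<in>Q_small. real (h 3))"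
    proof (intro sum_mono)
      fix q assume "q \<in> Q_small"
      then show "real (card (U q)) \<le> real (h 3)"
        using card_bohr_params_le[of n q a k h] by (simp add: Q_small_def)
    qed
    also have "\<dots> = real (card Q_small) * (1 * (real (h 3) * 1))" by simp
    also have "\<dots> \<le> real (card Q) * (K * (h 3 * M))"
    proof (rule mult_mono)
      show "real (card Q_small) \<le> real (card Q)"
        using card_mono[OF fin_Q, of Q_small] by (simp add: Q_small_def)
      show "1 * (real (h 3) * 1) \<le> K * (h 3 * M)"
        using K_ge_1 M_ge_1 by (intro mult_mono) auto
    qed auto
    finally show ?thesis .
  qed
  moreover have "(\<Sum>q\<in>Q_dvd. real (card (U q))) \<le> 30 * real K ^ 2 * (H * log1 M)"
  proof -
    have "(\<Sum>q\<in>Q_dvd. real (card (U q))) \<le> (\<Sum>q\<in>Q_dvd. 5 * real K * H)"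
    proof (intro sum_mono)
      fix q assume "q \<in> Q_dvd"
      then have "real (card (U q)) \<le> real (5 * K * (h 2 * h 3))"
        using card_U_le[of q] of_nat_mono unfolding Q_dvd_def by blast
      also have "\<dots> = 5 * real K * (real (h 2) * real (h 3))" by simp
      also have "\<dots> \<le> 5 * real K * H"
        using H_ge by (intro mult_left_mono) auto
      finally show "real (card (U q)) \<le> 5 * real K * H" .
    qed
    also have "\<dots> = real (card Q_dvd) * (5 * real K * H)" by simp
    also have "\<dots> \<le> (6 * log1 M) * (5 * real K * H)"
      using card_Q_dvd_le[OF assms] \<open>H \<ge> 0\<close> by (intro mult_right_mono) auto
    also have "\<dots> = 30 * real K * (H * log1 M)" by simp
    also have "\<dots> \<le> 30 * real K ^ 2 * (H * log1 M)"
      using K_ge_1 \<open>H \<ge> 0\<close> log1_ge_1[of M]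
      by (intro mult_right_mono mult_left_mono self_le_power) auto
    finally show ?thesis .
  qed
  ultimately show ?thesis
    using sum_card_U_coprime_le[OF assms] by (simp add: algebra_simps)
qed

text \<open>Joins the two ranges of \<open>A\<close>. The constant is \<open>312 = 4 * 78\<close>,
  the 4 coming from \<open>log1_square_le\<close>.\<close>

lemma average_card_U_le:
  assumes "Q \<noteq> {}"
  shows "(\<Sum>q\<in>Q. real (card (U q))) / real (card Q)
    \<le> 312 * real K ^ 2 * (h 3 * exp (2 * (L / log1 L + log1 M)) + H * M / (real (card Q) * log1 M))"
proof -
  define D where "D = real (card Q)"
  have D: "D > 0" using assms fin_Q by (simp add: D_def card_gt_0_iff)
  have pos: "log1 M > 0" "log1 L > 0" "M > 0" "L > 0" "H \<ge> 0"
    using log1_ge_1[of M] log1_ge_1[of L] M_ge_1 L_ge_1 by (auto simp: H_def)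
  define E where "E = exp (2 * (L / log1 L + log1 M))"
  have K2: "real K \<le> real K ^ 2"
    using K_ge_1 by (intro self_le_power) auto
  have rest: "0 \<le> 312 * real K ^ 2 * (H * M / (D * log1 M))"
    using D pos by simp
  have first: "x * real K * (h 3 * y) \<le> 312 * real K ^ 2 * (h 3 * E)"
    if "0 \<le> x" "x \<le> 312" "0 \<le> y" "y \<le> E" for x y :: real
    using that K2 by (intro mult_mono) auto
  have "(\<Sum>q\<in>Q. real (card (U q))) / D \<le> 312 * real K ^ 2 * (h 3 * E) + 312 * real K ^ 2 * (H * M / (D * log1 M))"
  proof (cases "M * log1 M \<le> L")
    case True
    have "(\<Sum>q\<in>Q. real (card (U q))) / D \<le> 5 * real K * (h 3 * exp (2 * (L / log1 L)))"
      using sum_card_U_le_large_A[OF True] D by (simp add: D_def field_simps)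
    also have "\<dots> \<le> 312 * real K ^ 2 * (h 3 * E)"
      using pos by (intro first) (auto simp: E_def)
    finally show ?thesis using rest by linarith
  next
    case False
    \<comment> \<open>The logarithmic loss \<open>M\<close> from the pair count is absorbed by the
      \<open>log1 M\<close> in the exponent.\<close>
    have "M = exp (ln M)" using pos by simp
    also have "\<dots> \<le> E"
      unfolding E_def exp_le_cancel_iff
    proof -
      have "0 \<le> L / log1 L" using pos by simp
      then show "ln M \<le> 2 * (L / log1 L + log1 M)"
        using ln_le_log1[of M] pos unfolding distrib_left by linarith
    qed
    finally have M_le: "M \<le> E" .
    have "log1 M \<le> 4 * (M / log1 M)"
      using log1_square_le[OF M_ge_1] pos by (simp add: power2_eq_square field_simps)
    then have "78 * real K ^ 2 * (H * log1 M) \<le> 78 * real K ^ 2 * (H * (4 * (M / log1 M)))"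
      using pos by (intro mult_left_mono) auto
    then have "(\<Sum>q\<in>Q. real (card (U q)))
        \<le> D * (18 * real K * (h 3 * M)) + 78 * real K ^ 2 * (H * (4 * (M / log1 M)))"
      using sum_card_U_le_small_A False unfolding D_def by simp
    then have "(\<Sum>q\<in>Q. real (card (U q))) / D
        \<le> (D * (18 * real K * (h 3 * M)) + 78 * real K ^ 2 * (H * (4 * (M / log1 M)))) / D"
      using D by (intro divide_right_mono) auto
    also have "\<dots> = 18 * real K * (h 3 * M) + 312 * real K ^ 2 * (H * M / (D * log1 M))"
      using D by (simp add: add_divide_distrib mult_ac)
    also have "18 * real K * (h 3 * M) \<le> 312 * real K ^ 2 * (h 3 * E)"
      using M_le pos by (intro first) auto
    finally show ?thesis by simp
  qed
  then show ?thesis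
    by (simp add: D_def E_def distrib_left)
qed

end

text \<open>\<open>C\<close> and \<open>c\<close> are chosen before \<open>h\<close>,
  \<open>A\<close>, \<open>a\<close> and \<open>Q\<close>, so they depend on \<open>n\<close> and
  \<open>k\<close> only. The divisibility condition on \<open>Q\<close> excludes primes for which,
  when \<open>n = 3\<close>, every element of the field would be counted.\<close>

theorem theorem2p3:
  fixes n :: nat and k :: "nat \<Rightarrow> nat"
  assumes "n \<ge> 3"
    and "\<forall>i\<in>{1..n}. k i > 0"
    and "inj_on k {1..n}"
  shows "\<exists>C>0::real. \<exists>c>0::real.
    \<forall>(h :: nat \<Rightarrow> nat) (A :: real) (a :: nat \<Rightarrow> int) (Q :: nat set).
      1 \<le> h 1 \<longrightarrow> mono_on {1..n} h \<longrightarrow>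
      (\<forall>i\<in>{1..n}. 0 < \<bar>a i\<bar> \<and> real_of_int \<bar>a i\<bar> \<le> A) \<longrightarrow>
      finite Q \<longrightarrow> Q \<noteq> {} \<longrightarrow> (\<forall>q\<in>Q. prime q) \<longrightarrow>
      (\<forall>q\<in>Q. card {i \<in> {1..3}. int q dvd a i} \<le> 1) \<longrightarrow>
      (\<Sum>q\<in>Q. real (card (bohr_params n q a k h))) / real (card Q)
        \<le> C * (real (h 3) * exp (c * (log1 A / log1 (log1 A) + log1 (log1 (real (h 3)))))
             + real (h 1) * real (h 2) * real (h 3) * log1 (real (h 3))
               / (real (card Q) * log1 (log1 (real (h 3)))))"
proof -
  have "k 1 > 0" using assms by auto
  then have C: "312 * real (k 1 + k 2 + k 3) ^ 2 > 0" by simp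
  show ?thesis
  proof (rule exI[of _ "312 * real (k 1 + k 2 + k 3) ^ 2"],
      intro exI[of _ "2 :: real"] conjI C allI impI)
    fix h :: "nat \<Rightarrow> nat" and A :: real and a :: "nat \<Rightarrow> int" and Q :: "nat set"
    assume *: "1 \<le> h 1" "mono_on {1..n} h" "\<forall>i\<in>{1..n}. 0 < \<bar>a i\<bar> \<and> real_of_int \<bar>a i\<bar> \<le> A"
      "finite Q" "Q \<noteq> {}" "\<forall>q\<in>Q. prime q" "\<forall>q\<in>Q. card {i \<in> {1..3}. int q dvd a i} \<le> 1"
    interpret bohr_average n k h A a Q
      using assms * by unfold_locales auto
    show "(\<Sum>q\<in>Q. real (card (bohr_params n q a k h))) / real (card Q)
        \<le> 312 * real (k 1 + k 2 + k 3) ^ 2 *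
          (real (h 3) * exp (2 * (log1 A / log1 (log1 A) + log1 (log1 (real (h 3)))))
             + real (h 1) * real (h 2) * real (h 3) * log1 (real (h 3))
               / (real (card Q) * log1 (log1 (real (h 3)))))"
      using average_card_U_le[OF \<open>Q \<noteq> {}\<close>] unfolding K_def L_def M_def H_def .
  qed simp
qed

end
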